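(* Let $n$ be a positive integer. Every self-overlapping permutation $\sigma \in S_n$ admits an overlapping range $k$ with $k \leqslant n/2$.
   Context: $S_n$ denotes the set of permutations $\sigma=\sigma_1\sigma_2\ldots\sigma_n$ of $\{1,\ldots,n\}$. Two sequences of distinct integers $\pi_1\ldots\pi_k$ and $\tau_1\ldots\tau_k$ are isomorphic if $\pi_i>\pi_j \Leftrightarrow \tau_i>\tau_j$ for all indices $i,j$. A permutation $\sigma\in S_n$ is self-overlapping if there is an integer $1\leqslant k<n$, called an overlapping range of $\sigma$, such that: (1) the interval $\{1,\ldots,k\}$ is invariant under $\sigma$; (2) the interval $\{n-k+1,\ldots,n\}$ is invariant under $\sigma$; (3) the sequences $\sigma_1\ldots\sigma_k$ and $\sigma_{n-k+1}\ldots\sigma_n$ are isomorphic. (A permutation may have several overlapping ranges.) *)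

theory Defs
  imports Complex_Main "HOL-Combinatorics.Permutations"
begin

text \<open>
  A permutation in \<open>S_n\<close> is a function \<open>\<sigma> :: nat \<Rightarrow> nat\<close> with \<open>\<sigma> permutes {1..n}\<close>,
  that is, a bijection of \<open>{1..n}\<close> extended by the identity outside this set.
\<close>

text \<open>
  Isomorphism of sequences. It is meant for sequences with distinct entries, and is
  only applied to such sequences below (consecutive values of a permutation).
\<close>

definition seq_isomorphic :: "'a::linorder list \<Rightarrow> 'b::linorder list \<Rightarrow> bool" where
  "seq_isomorphic xs ys \<longleftrightarrow>
     length xs = length ys \<and>
     (\<forall>i<length xs. \<forall>j<length xs. xs ! i > xs ! j \<longleftrightarrow> ys ! i > ys ! j)"

text \<open>The bound \<open>k < n\<close> also ensures that the subtraction \<open>n - k\<close> does not truncate.\<close>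

definition overlapping_range :: "nat \<Rightarrow> (nat \<Rightarrow> nat) \<Rightarrow> nat \<Rightarrow> bool" where
  "overlapping_range n \<sigma> k \<longleftrightarrow>
     1 \<le> k \<and> k < n \<and>
     \<sigma> ` {1..k} = {1..k} \<and>
     \<sigma> ` {n - k + 1..n} = {n - k + 1..n} \<and>
     seq_isomorphic (map \<sigma> [1..<k + 1]) (map \<sigma> [n - k + 1..<n + 1])"

definition self_overlapping :: "nat \<Rightarrow> (nat \<Rightarrow> nat) \<Rightarrow> bool" where
  "self_overlapping n \<sigma> \<longleftrightarrow> (\<exists>k. overlapping_range n \<sigma> k)"

end

theory Submission
  imports Defs
begin

text \<open>
  Two isomorphic sequences whose entries fill two intervals differ by a constant, because an
  entry is determined by its rank among the others. Hence \<open>k\<close> is an overlapping range exactly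
  if \<open>{1..k}\<close> is invariant and \<open>\<sigma>\<close> commutes on it with the translation by \<open>d = n - k\<close>
  (\<open>overlapping_range_iff_shift\<close>). If \<open>2 * k > n\<close>, then \<open>d < k\<close>, and the translation can be
  applied twice to the points of \<open>{1..k - d}\<close>. So \<open>k - d\<close> is a smaller overlapping range, with
  translation \<open>2 * d\<close> (\<open>overlapping_range_descent\<close>), and the least overlapping range is at
  most \<open>n / 2\<close>.
\<close>

lemma rank_in_interval:
  fixes f :: "'a \<Rightarrow> nat"
  assumes bij: "bij_betw f A {a + 1..a + k}" and i: "i \<in> A"
  shows "f i = a + card {j \<in> A. f j \<le> f i}"
proof -
  have fi: "f i \<in> {a + 1..a + k}"
    using bij i by (auto simp: bij_betw_def)
  have "f ` {j \<in> A. f j \<le> f i} = {y \<in> f ` A. y \<le> f i}"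
    by auto
  also have "\<dots> = {a + 1..f i}"
    using bij fi by (auto simp: bij_betw_def)
  finally have "card {j \<in> A. f j \<le> f i} = card {a + 1..f i}"
    using bij by (metis (no_types, lifting) bij_betw_def card_image inj_on_subset mem_Collect_eq subsetI)
  with fi show ?thesis
    by simp
qed

lemma seq_isomorphic_map_upt_iff:
  "seq_isomorphic (map f [1..<k + 1]) (map g [d + 1..<d + k + 1]) \<longleftrightarrow>
     (\<forall>i\<in>{1..k}. \<forall>j\<in>{1..k}. f j < f i \<longleftrightarrow> g (j + d) < g (i + d))"
proof -
  have "seq_isomorphic (map f [1..<k + 1]) (map g [d + 1..<d + k + 1]) \<longleftrightarrow>
    (\<forall>i\<in>{..<k}. \<forall>j\<in>{..<k}. f (Suc j) < f (Suc i) \<longleftrightarrow> g (Suc j + d) < g (Suc i + d))"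
    by (auto simp: seq_isomorphic_def add.commute simp del: upt_Suc)
  also have "\<dots> \<longleftrightarrow> (\<forall>i\<in>Suc ` {..<k}. \<forall>j\<in>Suc ` {..<k}. f j < f i \<longleftrightarrow> g (j + d) < g (i + d))"
    by blast
  also have "Suc ` {..<k} = {1..k}"
    by (simp add: image_Suc_lessThan)
  finally show ?thesis .
qed

text \<open>
  Isomorphism of the two sequences says that the values of \<open>\<sigma>\<close> at \<open>i\<close> and \<open>i + (n - k)\<close> have the
  same rank in their respective intervals, and these intervals differ by \<open>n - k\<close>. The invariance
  of the last \<open>k\<close> points does not appear on the right because they are the translates of the
  first \<open>k\<close> points.
\<close>

lemma overlapping_range_iff_shift:
  assumes "inj \<sigma>"
  shows "overlapping_range n \<sigma> k \<longleftrightarrow>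
    1 \<le> k \<and> k < n \<and> \<sigma> ` {1..k} = {1..k} \<and> (\<forall>i\<in>{1..k}. \<sigma> (i + (n - k)) = \<sigma> i + (n - k))"
    (is "?L \<longleftrightarrow> ?R")
proof (cases "k < n")
  case False
  then show ?thesis
    by (auto simp: overlapping_range_def)
next
  case True
  define d where "d = n - k"
  have n: "n = d + k"
    using True by (simp add: d_def)
  have last: "{d + 1..d + k} = (\<lambda>i. i + d) ` {1..k}"
    by (simp add: add.commute)
  have unfold: "?L \<longleftrightarrow> 1 \<le> k \<and> k < n \<and> \<sigma> ` {1..k} = {1..k} \<and> \<sigma> ` {d + 1..d + k} = {d + 1..d + k} \<and>
      (\<forall>i\<in>{1..k}. \<forall>j\<in>{1..k}. \<sigma> j < \<sigma> i \<longleftrightarrow> \<sigma> (j + d) < \<sigma> (i + d))"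
    by (simp only: overlapping_range_def n add_diff_cancel_right' seq_isomorphic_map_upt_iff)
  show ?thesis
    unfolding d_def[symmetric]
  proof
    assume ?L
    with unfold have first_inv: "\<sigma> ` {1..k} = {1..k}"
      and last_inv: "\<sigma> ` {d + 1..d + k} = {d + 1..d + k}"
      and iso: "\<And>i j. i \<in> {1..k} \<Longrightarrow> j \<in> {1..k} \<Longrightarrow> \<sigma> j < \<sigma> i \<longleftrightarrow> \<sigma> (j + d) < \<sigma> (i + d)"
      and k: "1 \<le> k"
      by blast+
    have bij: "bij_betw \<sigma> {1..k} {0 + 1..0 + k}"
      using \<open>inj \<sigma>\<close> first_inv by (auto simp: bij_betw_def intro: inj_on_subset)
    have "inj_on (\<lambda>i. \<sigma> (i + d)) {1..k}"
      by (intro inj_onI) (auto dest!: injD[OF \<open>inj \<sigma>\<close>])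
    moreover have "(\<lambda>i. \<sigma> (i + d)) ` {1..k} = {d + 1..d + k}"
      using last_inv unfolding last image_image .
    ultimately have bij_shift: "bij_betw (\<lambda>i. \<sigma> (i + d)) {1..k} {d + 1..d + k}"
      by (simp add: bij_betw_def)
    have "\<sigma> (i + d) = \<sigma> i + d" if i: "i \<in> {1..k}" for i
    proof -
      have "{j \<in> {1..k}. \<sigma> (j + d) \<le> \<sigma> (i + d)} = {j \<in> {1..k}. \<sigma> j \<le> \<sigma> i}"
        using iso[OF _ i] iso[OF i] by (auto simp: not_less[symmetric])
      then show ?thesis
        using rank_in_interval[OF bij i] rank_in_interval[OF bij_shift i] by simp
    qed
    with True k first_inv show "1 \<le> k \<and> k < n \<and> \<sigma> ` {1..k} = {1..k} \<and> (\<forall>i\<in>{1..k}. \<sigma> (i + d) = \<sigma> i + d)"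
      by blast
  next
    assume R: "1 \<le> k \<and> k < n \<and> \<sigma> ` {1..k} = {1..k} \<and> (\<forall>i\<in>{1..k}. \<sigma> (i + d) = \<sigma> i + d)"
    have "\<sigma> ` {d + 1..d + k} = (\<lambda>i. \<sigma> i + d) ` {1..k}"
      unfolding last image_image using R by (intro image_cong) auto
    also have "\<dots> = (\<lambda>i. i + d) ` \<sigma> ` {1..k}"
      by (simp add: image_image)
    also have "\<dots> = {d + 1..d + k}"
      using R last by simp
    finally show ?L
      using R unfold by simp
  qed
qed

text \<open>
  Here \<open>2 * k - n = k - (n - k)\<close> is the number of points that the translation by \<open>n - k\<close> maps
  from \<open>{1..k}\<close> into itself; these are the points at which the commutation with \<open>\<sigma>\<close> can be
  used twice.
\<close>

lemma overlapping_range_descent: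
  assumes "inj \<sigma>" and range: "overlapping_range n \<sigma> k" and large: "n < 2 * k"
  shows "overlapping_range n \<sigma> (2 * k - n)"
proof -
  define d where "d = n - k"
  have k: "k < n" and inv: "\<sigma> ` {1..k} = {1..k}"
    and shift: "\<And>i. i \<in> {1..k} \<Longrightarrow> \<sigma> (i + d) = \<sigma> i + d"
    using range overlapping_range_iff_shift[OF \<open>inj \<sigma>\<close>] by (auto simp: d_def)
  have d: "d < k" "2 * k - n = k - d" "n - (k - d) = d + d"
    using k large by (auto simp: d_def)
  have "\<sigma> i \<in> {1..k - d}" if i: "i \<in> {1..k - d}" for i
  proof -
    \<comment> \<open>The translate of \<open>i\<close> is still in the invariant interval, so its image \<open>\<sigma> i + d\<close> is, too.\<close>
    have "\<sigma> i \<in> {1..k}" "\<sigma> (i + d) \<in> {1..k}"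
      using i d inv image_eqI[of _ \<sigma> i "{1..k}"] image_eqI[of _ \<sigma> "i + d" "{1..k}"] by auto
    moreover have "\<sigma> (i + d) = \<sigma> i + d"
      using i by (intro shift) auto
    ultimately show ?thesis
      by auto
  qed
  then have "\<sigma> ` {1..k - d} = {1..k - d}"
    using \<open>inj \<sigma>\<close> by (intro endo_inj_surj) (auto intro: inj_on_subset)
  moreover have "\<sigma> (i + (d + d)) = \<sigma> i + (d + d)" if "i \<in> {1..k - d}" for i
    using shift[of i] shift[of "i + d"] that by (auto simp: add.assoc)
  moreover have "1 \<le> k - d" "k - d < n"
    using k d(1) by auto
  ultimately show ?thesis
    using d overlapping_range_iff_shift[OF \<open>inj \<sigma>\<close>, of n "k - d"] by simp
qed

theorem lemma2p1:
  fixes n :: nat and \<sigma> :: "nat \<Rightarrow> nat"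
  assumes "n > 0"
    and "\<sigma> permutes {1..n}"
    and "self_overlapping n \<sigma>"
  shows "\<exists>k. overlapping_range n \<sigma> k \<and> real k \<le> real n / 2"
proof -
  have inj: "inj \<sigma>"
    using assms(2) by (rule permutes_inj)
  define k where "k = (LEAST k. overlapping_range n \<sigma> k)"
  have k: "overlapping_range n \<sigma> k"
    using assms(3) unfolding self_overlapping_def k_def by (rule LeastI_ex)
  have "2 * k \<le> n"
  proof (rule ccontr)
    assume "\<not> 2 * k \<le> n"
    then have "overlapping_range n \<sigma> (2 * k - n)"
      using overlapping_range_descent[OF inj k] by simp
    then have "k \<le> 2 * k - n"
      unfolding k_def by (rule Least_le)
    with k \<open>\<not> 2 * k \<le> n\<close> show False
      by (auto simp: overlapping_range_def)
  qed
  with k show ?thesis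
    by (intro exI[of _ k]) simp
qed

end
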